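(* Up to taking variants, the atypical words are the factors of the words $aabab$, $abaaba$, and $aabbaab$. That is, a word $w\in\{a,b\}^+$ is atypical if and only if some variant of $w$ (possibly $w$ itself) is a factor of at least one of the words $aabab$, $abaaba$, $aabbaab$.
   Context: Let $\{a,b\}^+$ be the free semigroup (nonempty finite words) on $\{a,b\}$. Let $\mu$ be the endomorphism of $\{a,b\}^+$ with $\mu(a)=ab$, $\mu(b)=ba$, and let $\xi$ be the endomorphism with $\xi(a)=b$, $\xi(b)=a$. The Prouhet-Thue-Morse sequence $\mathbf{t}$ is the infinite word over $\{a,b\}$ whose prefix of length $2^n$ is $\mu^n(a)$ for every $n\ge 0$. A finite segment of an infinite word $a_1a_2\cdots$ is a word of the form $a_ka_{k+1}\cdots a_\ell$ with $k\le\ell$. A word $u$ is a factor of a word $v$ if $v=xuy$ for some (possibly empty) words $x,y$. A word $w\in\{a,b\}^+$ is atypical if it is a segment of $\mathbf{t}$ and there is an endomorphism $\varphi$ of the semigroup $\{a,b\}^+$ such that $\varphi(w)$ is also a segment of $\mathbf{t}$ and $\varphi$ is not of one of the forms $\mu^n$ or $\xi\circ\mu^n$ with $n\ge 0$ ($\mu^0$ is the identity). A variant of a word $w$ is a word obtained from $w$ by applying reversal, or $\xi$, or both. *)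

theory Defs
  imports Main "HOL-Library.Sublist" "HOL-Library.Omega_Words_Fun"
begin

datatype letter = A | B

text \<open>
  The free semigroup on the two letters is the set of nonempty lists under append.
  Maps on it are represented by functions on all lists; their value at the empty list is irrelevant.
\<close>

definition endomorphism :: "(letter list \<Rightarrow> letter list) \<Rightarrow> bool" where
  "endomorphism \<phi> \<longleftrightarrow>
     (\<forall>u. u \<noteq> [] \<longrightarrow> \<phi> u \<noteq> []) \<and>
     (\<forall>u v. u \<noteq> [] \<longrightarrow> v \<noteq> [] \<longrightarrow> \<phi> (u @ v) = \<phi> u @ \<phi> v)"

definition eq_on_words :: "(letter list \<Rightarrow> letter list) \<Rightarrow> (letter list \<Rightarrow> letter list) \<Rightarrow> bool" where
  "eq_on_words \<phi> \<psi> \<longleftrightarrow> (\<forall>u. u \<noteq> [] \<longrightarrow> \<phi> u = \<psi> u)"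

definition mu :: "letter list \<Rightarrow> letter list" where
  "mu w = concat (map (\<lambda>x. case x of A \<Rightarrow> [A, B] | B \<Rightarrow> [B, A]) w)"

definition xi :: "letter list \<Rightarrow> letter list" where
  "xi w = map (\<lambda>x. case x of A \<Rightarrow> B | B \<Rightarrow> A) w"

lemma endomorphism_mu: "endomorphism mu"
  by (auto simp: endomorphism_def mu_def split: letter.splits)
     (metis letter.exhaust list.set_intros(1) neq_Nil_conv)

lemma endomorphism_xi: "endomorphism xi"
  by (auto simp: endomorphism_def xi_def)

text \<open>Well-definedness of this description is \<open>ex1_ptm\<close> below.\<close>

definition ptm :: "letter word" where
  "ptm = (THE t. \<forall>n. t [0 \<rightarrow> 2 ^ n] = (mu ^^ n) [A])"

lemma mu_append: "mu (u @ v) = mu u @ mu v"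
  by (simp add: mu_def)

lemma length_mu: "length (mu w) = 2 * length w"
  by (induction w) (auto simp: mu_def split: letter.splits)

lemma length_mu_pow: "length ((mu ^^ n) w) = 2 ^ n * length w"
  by (induction n) (auto simp: length_mu)

lemma mu_pow_Suc_prefix: "\<exists>v. (mu ^^ Suc n) [A] = (mu ^^ n) [A] @ v"
proof (induction n)
  case 0
  show ?case by (simp add: mu_def)
next
  case (Suc n)
  then obtain v where "(mu ^^ Suc n) [A] = (mu ^^ n) [A] @ v" by blast
  then have "mu ((mu ^^ Suc n) [A]) = mu ((mu ^^ n) [A]) @ mu v"
    by (simp only: mu_append)
  then show ?case by auto
qed

lemma mu_pow_prefix:
  assumes "m \<le> n"
  shows "\<exists>v. (mu ^^ n) [A] = (mu ^^ m) [A] @ v"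
  using assms
proof (induction n rule: dec_induct)
  case base
  show ?case by simp
next
  case (step n)
  then show ?case using mu_pow_Suc_prefix[of n] by auto
qed

lemma mu_pow_nth:
  assumes "i < 2 ^ m" "i < 2 ^ n"
  shows "(mu ^^ m) [A] ! i = (mu ^^ n) [A] ! i"
proof -
  have "(mu ^^ m) [A] ! i = (mu ^^ n) [A] ! i" if le: "m \<le> n" and lt: "i < 2 ^ m" for m n
    using mu_pow_prefix[OF le] lt length_mu_pow[of m "[A]"] by (auto simp: nth_append)
  then show ?thesis using assms by (metis nat_le_linear)
qed

lemma ex1_ptm: "\<exists>!t::letter word. \<forall>n. t [0 \<rightarrow> 2 ^ n] = (mu ^^ n) [A]"
proof (rule ex1I)
  let ?t = "\<lambda>i. (mu ^^ i) [A] ! i"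
  show "\<forall>n. ?t [0 \<rightarrow> 2 ^ n] = (mu ^^ n) [A]"
  proof
    fix n
    show "?t [0 \<rightarrow> 2 ^ n] = (mu ^^ n) [A]"
    proof (rule nth_equalityI)
      show "length (?t [0 \<rightarrow> 2 ^ n]) = length ((mu ^^ n) [A])"
        by (simp add: length_mu_pow)
    next
      fix i assume "i < length (?t [0 \<rightarrow> 2 ^ n])"
      then have i: "i < 2 ^ n" by simp
      then have "?t [0 \<rightarrow> 2 ^ n] ! i = ?t i"
        by (simp add: subsequence_def)
      also have "\<dots> = (mu ^^ n) [A] ! i"
        using i by (intro mu_pow_nth less_exp)
      finally show "?t [0 \<rightarrow> 2 ^ n] ! i = (mu ^^ n) [A] ! i" .
    qed
  qed
next
  fix t :: "letter word"
  assume t: "\<forall>n. t [0 \<rightarrow> 2 ^ n] = (mu ^^ n) [A]"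
  show "t = (\<lambda>i. (mu ^^ i) [A] ! i)"
  proof
    fix i
    have "(mu ^^ i) [A] ! i = t [0 \<rightarrow> 2 ^ i] ! i" using t by simp
    also have "\<dots> = t i" by (simp add: subsequence_def)
    finally show "t i = (mu ^^ i) [A] ! i" by simp
  qed
qed

lemma ptm_prefix: "ptm [0 \<rightarrow> 2 ^ n] = (mu ^^ n) [A]"
  using theI'[OF ex1_ptm] unfolding ptm_def by blast

text \<open>\<open>t [k \<rightarrow> Suc l]\<close> consists of the letters at positions \<open>k, \<dots>, l\<close>, counted from 0.\<close>

definition segment :: "letter list \<Rightarrow> letter word \<Rightarrow> bool" where
  "segment u t \<longleftrightarrow> (\<exists>k l. k \<le> l \<and> u = t [k \<rightarrow> Suc l])"

definition atypical :: "letter list \<Rightarrow> bool" where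
  "atypical w \<longleftrightarrow>
     segment w ptm \<and>
     (\<exists>\<phi>. endomorphism \<phi> \<and> segment (\<phi> w) ptm \<and>
       \<not> (\<exists>n. eq_on_words \<phi> (mu ^^ n) \<or> eq_on_words \<phi> (xi \<circ> mu ^^ n)))"

definition variants :: "letter list \<Rightarrow> letter list set" where
  "variants w = {w, rev w, xi w, xi (rev w)}"

end

theory Submission
  imports Defs
begin

text \<open>
  Atypicality is inherited by factors and invariant under variants, so it suffices to exhibit
  endomorphisms for \<open>aabab\<close>, \<open>abaaba\<close>, \<open>aabbaab\<close> and to show that the minimal segments outside
  their variants' factors, up to variants \<open>aababb\<close>, \<open>aabbab\<close>, \<open>ababba\<close>, \<open>abbaabba\<close>,
  are not atypical. Let \<open>m\<close> be one of these and \<open>\<phi>(m)\<close> a segment. A word that occurs in \<open>t\<close> at positions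
  of both parities is alternating of length at most 4; hence, apart from finitely many pairs that
  are checked directly, \<open>\<phi>(a)\<close> and \<open>\<phi>(b)\<close> have even length. If \<open>\<phi>(m)\<close> starts at an even position, then
  \<open>\<phi> = \<mu> \<circ> \<phi>'\<close> and induction applies to \<open>\<phi>'\<close>. If it starts at an odd position, then \<open>\<phi>(a)\<close> and \<open>\<phi>(b)\<close> end in
  the same letter, and moving this letter to the front reduces to the even case,
  where the images of \<open>a\<close> and \<open>b\<close> begin with different letters.
\<close>

section \<open>Letter exchange, reversal and powers of \<open>mu\<close>\<close>

primrec flip :: "letter \<Rightarrow> letter" where
  "flip A = B"
| "flip B = A"

lemma flip_flip [simp]: "flip (flip x) = x"
  by (cases x) auto

lemma flip_eq_iff [simp]: "flip x = flip y \<longleftrightarrow> x = y"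
  by (cases x; cases y) auto

lemma neq_iff_flip: "x \<noteq> y \<longleftrightarrow> y = flip x"
  by (cases x; cases y) auto

lemma flip_neq [simp]: "flip x \<noteq> x" "x \<noteq> flip x"
  by (cases x; simp)+

lemma xi_eq_map_flip: "xi = map flip"
  by (auto simp: xi_def fun_eq_iff split: letter.split)

lemma mu_simps [simp]: "mu [] = []" "mu (x # w) = x # flip x # mu w"
  by (cases x; simp add: mu_def)+

lemma xi_xi [simp]: "xi (xi w) = w"
  by (simp add: xi_eq_map_flip comp_def)

lemma xi_rev: "xi (rev w) = rev (xi w)"
  by (simp add: xi_eq_map_flip rev_map)

lemma mu_xi: "mu (xi w) = xi (mu w)"
  by (induction w) (auto simp: xi_eq_map_flip)

lemma mu_rev: "mu (rev w) = xi (rev (mu w))"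
  by (induction w) (auto simp: xi_eq_map_flip mu_append)

lemma mu_pow_append: "(mu ^^ n) (u @ v) = (mu ^^ n) u @ (mu ^^ n) v"
  by (induction n) (auto simp: mu_append)

lemma mu_pow_xi: "(mu ^^ n) (xi w) = xi ((mu ^^ n) w)"
  by (induction n) (auto simp: mu_xi)

lemma mu_pow_flip: "(mu ^^ n) [flip x] = xi ((mu ^^ n) [x])"
  using mu_pow_xi[of n "[x]"] by (simp add: xi_eq_map_flip)

text \<open>By \<open>mu_rev\<close>, moving reversal past \<open>mu\<close> costs one application
  of \<open>xi\<close>, so the two alternatives swap with every power.\<close>

lemma mu_pow_rev: "rev ((mu ^^ n) [x]) = (mu ^^ n) [x] \<or> rev ((mu ^^ n) [x]) = xi ((mu ^^ n) [x])"
proof (induction n)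
  case (Suc n)
  have "rev (mu w) = xi (mu (rev w))" for w
    by (simp add: mu_rev)
  then show ?case
    using Suc by (metis comp_apply funpow.simps(2) mu_xi xi_xi)
qed simp

lemma hd_mu_pow: "\<exists>w. (mu ^^ n) [x] = x # w"
  by (induction n) auto

lemma mu_pow_Suc_eq: "(mu ^^ Suc n) [x] = (mu ^^ n) [x] @ xi ((mu ^^ n) [x])"
  using mu_pow_append[of n "[x]" "[flip x]"] by (simp add: funpow_swap1 mu_pow_flip)


section \<open>Occurrences in the Prouhet--Thue--Morse word\<close>

text \<open>Recursion on the word lets an occurrence split over concatenation with explicit
  positions for the pieces; the parities of these positions carry the argument.\<close>

primrec occurs_at :: "nat \<Rightarrow> letter list \<Rightarrow> bool" where
  "occurs_at k [] \<longleftrightarrow> True"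
| "occurs_at k (x # w) \<longleftrightarrow> ptm k = x \<and> occurs_at (Suc k) w"

lemma occurs_at_append [simp]:
  "occurs_at k (u @ v) \<longleftrightarrow> occurs_at k u \<and> occurs_at (k + length u) v"
  by (induction u arbitrary: k) auto

lemma occurs_at_iff_map: "occurs_at k w \<longleftrightarrow> w = map ptm [k..<k + length w]"
  by (induction w arbitrary: k) (auto simp: upt_conv_Cons simp del: upt_Suc)

lemma occurs_at_map [simp]: "occurs_at k (map ptm [k..<l])"
  by (cases "k \<le> l") (simp_all add: occurs_at_iff_map)

lemma segment_iff: "segment w ptm \<longleftrightarrow> w \<noteq> [] \<and> (\<exists>k. occurs_at k w)"
proof
  assume "segment w ptm"
  then show "w \<noteq> [] \<and> (\<exists>k. occurs_at k w)"
    unfolding segment_def subsequence_def by (auto intro: occurs_at_map simp del: upt_Suc)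
next
  assume "w \<noteq> [] \<and> (\<exists>k. occurs_at k w)"
  then obtain k where "w \<noteq> []" "w = map ptm [k..<k + length w]"
    using occurs_at_iff_map by blast
  then have "k \<le> k + length w - 1" "w = ptm [k \<rightarrow> Suc (k + length w - 1)]"
    unfolding subsequence_def by (cases w, simp_all)
  then show "segment w ptm"
    unfolding segment_def by blast
qed

lemma segment_sublist:
  assumes "segment w ptm" "sublist v w" "v \<noteq> []"
  shows "segment v ptm"
  using assms by (auto simp: segment_iff sublist_def)

text \<open>Passing to finite prefixes gives access to the symmetries of \<open>mu ^^ n\<close> and,
  later, to evaluation.\<close>

lemma segment_iff_sublist_mu_pow: "segment w ptm \<longleftrightarrow> w \<noteq> [] \<and> (\<exists>n. sublist w ((mu ^^ n) [A]))"
proof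
  assume "segment w ptm"
  then obtain k where w: "w \<noteq> []" "w = map ptm [k..<k + length w]"
    using segment_iff occurs_at_iff_map by blast
  \<comment> \<open>The occurrence ends before position \<open>?n\<close>, and
    \<open>?n < 2 ^ ?n\<close>, so the prefix \<open>(mu ^^ ?n) [A]\<close> contains it.\<close>
  let ?n = "k + length w"
  have "?n \<le> 2 ^ ?n"
    using less_exp[of ?n] by simp
  then have "[0..<2 ^ ?n] = [0..<k] @ [k..<?n] @ [?n..<2 ^ ?n]"
    using upt_add_eq_append[of 0 k "length w"] upt_add_eq_append[of 0 ?n "2 ^ ?n - ?n"] by simp
  then have "(mu ^^ ?n) [A] = map ptm [0..<k] @ w @ map ptm [?n..<2 ^ ?n]"
    using w(2) by (metis map_append ptm_prefix subsequence_def)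
  then show "w \<noteq> [] \<and> (\<exists>n. sublist w ((mu ^^ n) [A]))"
    using w(1) unfolding sublist_def by blast
next
  assume "w \<noteq> [] \<and> (\<exists>n. sublist w ((mu ^^ n) [A]))"
  then obtain n where "w \<noteq> []" and n: "sublist w ((mu ^^ n) [A])"
    by blast
  moreover have "occurs_at 0 ((mu ^^ n) [A])"
    by (metis occurs_at_map ptm_prefix subsequence_def)
  then have "segment ((mu ^^ n) [A]) ptm"
    using hd_mu_pow[of n A] by (auto simp: segment_iff simp del: occurs_at.simps)
  ultimately show "segment w ptm"
    using segment_sublist by blast
qed

lemma sublist_xi: "sublist (xi u) (xi v) \<longleftrightarrow> sublist u v"
proof -
  have "sublist (xi u) (xi v)" if "sublist u v" for u v
    using that unfolding sublist_def xi_eq_map_flip by (metis map_append)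
  from this[of u v] this[of "xi u" "xi v"] show ?thesis
    by auto
qed

lemma segment_xi: "segment (xi w) ptm \<longleftrightarrow> segment w ptm"
proof -
  have "segment (xi w) ptm" if w: "segment w ptm" for w
  proof -
    obtain n where "w \<noteq> []" "sublist w ((mu ^^ n) [A])"
      using w unfolding segment_iff_sublist_mu_pow by blast
    \<comment> \<open>The second half of each power is the exchanged first half.\<close>
    moreover have "sublist (xi ((mu ^^ n) [A])) ((mu ^^ Suc n) [A])"
      unfolding mu_pow_Suc_eq sublist_def by (metis append_Nil2)
    ultimately have "sublist (xi w) ((mu ^^ Suc n) [A])"
      using sublist_xi sublist_order.order_trans by blast
    moreover have "xi w \<noteq> []"
      using \<open>w \<noteq> []\<close> by (simp add: xi_eq_map_flip)
    ultimately show ?thesis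
      unfolding segment_iff_sublist_mu_pow by blast
  qed
  from this[of w] this[of "xi w"] show ?thesis
    by auto
qed

lemma segment_rev: "segment (rev w) ptm \<longleftrightarrow> segment w ptm"
proof -
  have "segment (rev w) ptm" if w: "segment w ptm" for w
  proof -
    obtain n where n: "w \<noteq> []" "sublist w ((mu ^^ n) [A])"
      using w unfolding segment_iff_sublist_mu_pow by blast
    then have "sublist (rev w) (rev ((mu ^^ n) [A]))"
      by simp
    \<comment> \<open>A reversed power is the power itself or its exchange;
      \<open>segment_xi\<close> removes the second possibility.\<close>
    then have "sublist (rev w) ((mu ^^ n) [A]) \<or> sublist (xi (rev w)) ((mu ^^ n) [A])"
      using mu_pow_rev[of n A] sublist_xi by (metis xi_xi)
    then have "segment (rev w) ptm \<or> segment (xi (rev w)) ptm"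
      using n(1) unfolding segment_iff_sublist_mu_pow xi_eq_map_flip by auto
    then show ?thesis
      by (simp add: segment_xi)
  qed
  from this[of w] this[of "rev w"] show ?thesis
    by auto
qed

section \<open>Letters at even and odd positions\<close>

lemma mu_nth: "i < length w \<Longrightarrow> mu w ! (2 * i) = w ! i \<and> mu w ! Suc (2 * i) = flip (w ! i)"
  by (induction w arbitrary: i) (auto simp: nth_Cons split: nat.split)

lemma mu_pow_eq_map_ptm: "(mu ^^ n) [A] = map ptm [0..<2 ^ n]"
  using ptm_prefix[of n] by (simp add: subsequence_def)

text \<open>These equations make \<open>ptm\<close> a fixed point of \<open>mu\<close>; they come
  from comparing a prefix with its image.\<close>

lemma ptm_double [simp]: "ptm (2 * i) = ptm i" and ptm_Suc_double [simp]: "ptm (Suc (2 * i)) = flip (ptm i)"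
proof -
  have lt: "i < 2 ^ i"
    by (rule less_exp)
  then have Suc_double_lt: "Suc (2 * i) < 2 * 2 ^ i"
    by linarith
  have "map ptm [0..<2 ^ Suc i] = mu (map ptm [0..<2 ^ i])"
    by (simp only: mu_pow_eq_map_ptm[symmetric] funpow.simps comp_def)
  moreover have "map ptm [0..<2 ^ Suc i] ! (2 * i) = ptm (2 * i)"
    "map ptm [0..<2 ^ Suc i] ! Suc (2 * i) = ptm (Suc (2 * i))"
    using lt Suc_double_lt by (simp_all del: upt_Suc)
  ultimately show "ptm (2 * i) = ptm i" "ptm (Suc (2 * i)) = flip (ptm i)"
    using mu_nth[of i "map ptm [0..<2 ^ i]"] lt by auto
qed

lemma ptm_Suc_even: "even k \<Longrightarrow> ptm (Suc k) = flip (ptm k)"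
  by (auto elim!: evenE)

lemma occurs_at_mu: "occurs_at (2 * k) (mu w) \<longleftrightarrow> occurs_at k w"
proof (induction w arbitrary: k)
  case (Cons x w)
  show ?case
    using Cons[of "Suc k"] by auto
qed simp

text \<open>An even start aligns the word with the blocks \<open>mu [x]\<close>, and even length
  keeps the last block whole.\<close>

lemma occurs_at_even_imp_mu:
  assumes "occurs_at k w" "even k" "even (length w)"
  obtains w' where "w = mu w'"
proof -
  have "\<exists>w'. w = mu w'"
    using assms
  proof (induction w arbitrary: k rule: induct_list012)
    case (3 x y w)
    then obtain w' where "w = mu w'"
      by (metis even_Suc length_Cons occurs_at.simps(2))
    then have "x # y # w = mu (x # w')"
      using 3 ptm_Suc_even[of k] by auto
    then show ?case
      by blast
  qed (auto intro: exI[of _ "[]"])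
  with that show ?thesis
    by blast
qed

text \<open>One of \<open>q\<close> and \<open>Suc q\<close> is even, and a letter at an even
  position is followed by the other letter.\<close>

lemma no_cube_ptm: "\<not> (ptm (Suc q) = ptm q \<and> ptm (Suc (Suc q)) = ptm q)"
  using ptm_Suc_even[of q] ptm_Suc_even[of "Suc q"] by (cases "even q") auto

definition alternating_words :: "letter list set" where
  "alternating_words = {[], [A], [B], [A, B], [B, A], [A, B, A], [B, A, B], [A, B, A, B], [B, A, B, A]}"

text \<open>A repeated letter occurs in the word only at an odd position, and five alternating letters
  desubstitute to a cube.\<close>

lemma occurs_at_both_parities:
  assumes "occurs_at j w" "occurs_at k w" "odd (j + k)"
  shows "w \<in> alternating_words"
proof -
  \<comment> \<open>One of \<open>j\<close> and \<open>k\<close> is even, and there the first two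
    letters form a block of \<open>mu\<close>.\<close>
  have step: "\<exists>v. w = x # flip x # v" if "w = x # y # v" "occurs_at j w" "occurs_at k w" "odd (j + k)"
    for x y v w j k
    using that ptm_Suc_even[of j] ptm_Suc_even[of k] by (cases "even j") auto
  have "odd (Suc j + Suc k)" "odd (Suc (Suc j) + Suc (Suc k))"
    "odd (Suc (Suc (Suc j)) + Suc (Suc (Suc k)))"
    using assms by auto
  note steps = this
  show ?thesis
  proof (cases "length w \<ge> 5")
    case True
    then obtain a b c d e v where w: "w = a # b # c # d # e # v"
      by (auto simp: numeral_eq_Suc Suc_le_length_iff)
    have alt: "b = flip a" "c = flip b" "d = flip c" "e = flip d"
      using step[of w a b "c # d # e # v" j k] step[of "tl w" b c "d # e # v" "Suc j" "Suc k"]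
        step[of "tl (tl w)" c d "e # v" "Suc (Suc j)" "Suc (Suc k)"]
        step[of "tl (tl (tl w))" d e v "Suc (Suc (Suc j))" "Suc (Suc (Suc k))"]
        assms steps unfolding w by auto
    show ?thesis
    \<comment> \<open>The first, third and fifth letters agree; halving their positions gives three
      equal consecutive letters of \<open>ptm\<close>.\<close>
    proof (cases "even j")
      case True
      then obtain q where q: "j = 2 * q" by (elim evenE)
      have "ptm (2 * Suc q) = ptm (2 * q)" "ptm (2 * Suc (Suc q)) = ptm (2 * q)"
        using assms(1) unfolding w q alt by simp_all
      then show ?thesis
        using no_cube_ptm[of q] unfolding ptm_double by blast
    next
      case False
      then obtain q where q: "j = Suc (2 * q)" by (auto elim!: oddE)
      have "ptm (Suc (2 * Suc q)) = ptm (Suc (2 * q))" "ptm (Suc (2 * Suc (Suc q))) = ptm (Suc (2 * q))"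
        using assms(1) unfolding w q alt by simp_all
      then have "flip (flip (ptm (Suc q))) = flip (flip (ptm q))"
        "flip (flip (ptm (Suc (Suc q)))) = flip (flip (ptm q))"
        by (simp_all only: ptm_Suc_double)
      then show ?thesis
        using no_cube_ptm[of q] by simp
    qed
  next
    case False
    then consider "w = []" | a where "w = [a]" | a b where "w = [a, b]"
      | a b c where "w = [a, b, c]" | a b c d where "w = [a, b, c, d]"
      by (cases w; cases "tl w"; cases "tl (tl w)"; cases "tl (tl (tl w))"; cases "tl (tl (tl (tl w)))") auto
    then show ?thesis
    proof cases
      case 1 then show ?thesis by (simp add: alternating_words_def)
    next
      case (2 a) then show ?thesis by (cases a) (auto simp: alternating_words_def)
    next
      case (3 a b)
      then show ?thesis using step[of w a b "[]" j k] assms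
        by (cases a) (auto simp: alternating_words_def)
    next
      case (4 a b c)
      then show ?thesis
        using step[of w a b "[c]" j k] step[of "tl w" b c "[]" "Suc j" "Suc k"] assms steps
        by (cases a) (auto simp: alternating_words_def)
    next
      case (5 a b c d)
      then show ?thesis
        using step[of w a b "[c, d]" j k] step[of "tl w" b c "[d]" "Suc j" "Suc k"]
          step[of "tl (tl w)" c d "[]" "Suc (Suc j)" "Suc (Suc k)"] assms steps
        by (cases a) (auto simp: alternating_words_def)
    qed
  qed
qed

text \<open>The property used is that each of these words begins and ends with the same
  letter.\<close>

definition odd_alternating_words :: "letter list set" where
  "odd_alternating_words = {[A], [B], [A, B, A], [B, A, B]}"

lemma odd_alternatingD:
  assumes "w \<in> alternating_words" "odd (length w)"
  shows "w \<in> odd_alternating_words"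
  using assms by (auto simp: alternating_words_def odd_alternating_words_def)

lemma odd_square:
  assumes "occurs_at k u" "occurs_at (k + length u) u" "odd (length u)"
  shows "u \<in> odd_alternating_words"
  using occurs_at_both_parities[OF assms(1,2)] assms(3) odd_alternatingD by simp

text \<open>The last letter of \<open>u\<close> is at an even position, so it forms a block of
  \<open>mu\<close> with the first letter of \<open>v\<close>.\<close>

lemma last_neq_hd:
  assumes "occurs_at k u" "occurs_at (k + length u) v" "odd (k + length u)" "u \<noteq> []" "v \<noteq> []"
  shows "last u \<noteq> hd v"
proof -
  obtain u' x where "u = u' @ [x]" using \<open>u \<noteq> []\<close> by (metis append_butlast_last_id)
  moreover obtain y v' where "v = y # v'" using \<open>v \<noteq> []\<close> by (metis list.exhaust)
  ultimately show ?thesis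
    using assms ptm_Suc_even[of "k + length u'"] by auto
qed


section \<open>A decidable necessary condition for occurrence\<close>

text \<open>A partial inverse of \<open>mu\<close>. A single letter left at the end opens a
  truncated block and determines it.\<close>

fun halve :: "letter list \<Rightarrow> letter list option" where
  "halve [] = Some []"
| "halve [x] = Some [x]"
| "halve (x # y # w) = (if x = y then None else map_option (Cons x) (halve w))"

text \<open>The disjuncts are the two parities of a starting position; at an odd one,
  \<open>flip (hd w)\<close> completes the block cut on the left. The number counts levels of
  desubstitution.\<close>

primrec desubstitutable :: "nat \<Rightarrow> letter list \<Rightarrow> bool" where
  "desubstitutable 0 w \<longleftrightarrow> True"
| "desubstitutable (Suc n) w \<longleftrightarrow>
     (case halve w of None \<Rightarrow> False | Some w' \<Rightarrow> desubstitutable n w') \<or>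
     (case halve (flip (hd w) # w) of None \<Rightarrow> False | Some w' \<Rightarrow> desubstitutable n w')"

lemma halve_occurs_at: "occurs_at (2 * k) w \<Longrightarrow> \<exists>w'. halve w = Some w' \<and> occurs_at k w'"
proof (induction w arbitrary: k rule: halve.induct)
  case (3 x y w)
  then have "occurs_at (2 * Suc k) w" "x = ptm k" "y = flip x"
    by auto
  then show ?case
    using 3(1)[of "Suc k"] by auto
qed auto

lemma desubstitutable_if_occurs_at: "occurs_at k w \<Longrightarrow> w \<noteq> [] \<Longrightarrow> desubstitutable n w"
proof (induction n arbitrary: k w)
  case (Suc n)
  have *: "\<exists>w'. halve v = Some w' \<and> desubstitutable n w'" if "occurs_at (2 * q) v" "v \<noteq> []" for q v
  proof -
    obtain w' where w': "halve v = Some w'" "occurs_at q w'"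
      using halve_occurs_at \<open>occurs_at (2 * q) v\<close> by blast
    then have "w' \<noteq> []"
      using \<open>v \<noteq> []\<close> by (cases v rule: halve.cases) (auto split: if_splits)
    then show ?thesis
      using Suc.IH w' by blast
  qed
  show ?case
  proof (cases "even k")
    case True
    then show ?thesis
      using *[of "k div 2" w] Suc.prems by auto
  next
    case False
    then obtain q where "k = Suc (2 * q)" by (auto elim!: oddE)
    then have "occurs_at (2 * q) (flip (hd w) # w)"
      using Suc.prems by (cases w) auto
    then show ?thesis
      using * by fastforce
  qed
qed simp


section \<open>Endomorphisms\<close>

definition morph :: "letter list \<Rightarrow> letter list \<Rightarrow> letter list \<Rightarrow> letter list" where
  "morph u v w = concat (map (\<lambda>x. case x of A \<Rightarrow> u | B \<Rightarrow> v) w)"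

lemma morph_simps [simp]:
  "morph u v [] = []" "morph u v (A # w) = u @ morph u v w" "morph u v (B # w) = v @ morph u v w"
  by (simp_all add: morph_def)

lemma morph_append: "morph u v (w @ w') = morph u v w @ morph u v w'"
  by (simp add: morph_def)

lemma morph_eq_Nil: "u \<noteq> [] \<Longrightarrow> v \<noteq> [] \<Longrightarrow> morph u v w = [] \<longleftrightarrow> w = []"
  by (cases w; cases "hd w") auto

lemma endomorphism_morph: "u \<noteq> [] \<Longrightarrow> v \<noteq> [] \<Longrightarrow> endomorphism (morph u v)"
  by (simp add: endomorphism_def morph_eq_Nil morph_append)

lemma endomorphism_eq_morph:
  assumes "endomorphism \<phi>" "w \<noteq> []"
  shows "\<phi> w = morph (\<phi> [A]) (\<phi> [B]) w"
  using assms(2)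
proof (induction w rule: list_nonempty_induct)
  case (single x)
  then show ?case by (cases x) auto
next
  case (cons x w)
  then have "\<phi> (x # w) = \<phi> [x] @ \<phi> w"
    using assms(1) unfolding endomorphism_def by (metis append_Cons append_Nil list.distinct(1))
  then show ?case using cons by (cases x) auto
qed

lemma mu_morph: "mu (morph u v w) = morph (mu u) (mu v) w"
proof (induction w)
  case (Cons x w)
  then show ?case by (cases x) (auto simp: mu_append)
qed simp

lemma morph_rev: "morph (rev u) (rev v) (rev w) = rev (morph u v w)"
proof (induction w)
  case (Cons x w)
  then show ?case by (cases x) (auto simp: morph_append)
qed simp

lemma morph_xi: "morph v u (xi w) = morph u v w"
proof (induction w)
  case (Cons x w)
  then show ?case by (cases x) (auto simp: xi_eq_map_flip)
qed (simp add: xi_eq_map_flip)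

text \<open>The letter images under the permitted endomorphisms: \<open>x = A\<close> gives
  \<open>mu ^^ n\<close>, and \<open>x = B\<close> gives \<open>xi \<circ> mu ^^ n\<close>.\<close>

definition typical_pair :: "letter list \<Rightarrow> letter list \<Rightarrow> bool" where
  "typical_pair u v \<longleftrightarrow> (\<exists>n x. u = (mu ^^ n) [x] \<and> v = (mu ^^ n) [flip x])"

lemma typical_pair_commute: "typical_pair u v \<Longrightarrow> typical_pair v u"
  unfolding typical_pair_def by (metis flip_flip)

lemma typical_pair_letters [simp]: "typical_pair [x] [flip x]"
  unfolding typical_pair_def by (rule exI[of _ 0]) auto

lemma typical_pair_mu: "typical_pair u v \<Longrightarrow> typical_pair (mu u) (mu v)"
  unfolding typical_pair_def by (metis funpow.simps(2) comp_apply)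

lemma typical_pair_hd: "typical_pair u v \<Longrightarrow> hd u \<noteq> hd v"
  unfolding typical_pair_def using hd_mu_pow by (metis flip_neq(1) list.sel(1))

text \<open>By \<open>mu_pow_rev\<close>, reversal either fixes both words of the pair or exchanges
  them.\<close>

lemma typical_pair_rev: "typical_pair u v \<Longrightarrow> typical_pair (rev u) (rev v)"
proof -
  assume "typical_pair u v"
  then obtain n x where uv: "u = (mu ^^ n) [x]" "v = (mu ^^ n) [flip x]"
    unfolding typical_pair_def by blast
  have "rev ((mu ^^ n) [x]) = (mu ^^ n) [x] \<or> rev ((mu ^^ n) [x]) = (mu ^^ n) [flip x]"
    unfolding mu_pow_flip by (rule mu_pow_rev)
  then show ?thesis
  proof
    assume *: "rev ((mu ^^ n) [x]) = (mu ^^ n) [x]"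
    then have "rev ((mu ^^ n) [flip x]) = (mu ^^ n) [flip x]"
      unfolding mu_pow_flip by (metis xi_rev)
    with * show ?thesis
      unfolding uv typical_pair_def by auto
  next
    assume *: "rev ((mu ^^ n) [x]) = (mu ^^ n) [flip x]"
    then have "rev ((mu ^^ n) [flip x]) = (mu ^^ n) [x]"
      by (metis rev_swap)
    with * show ?thesis
      unfolding uv typical_pair_def by (metis flip_flip)
  qed
qed

lemma eq_on_words_iff:
  assumes "endomorphism \<phi>" "endomorphism \<psi>"
  shows "eq_on_words \<phi> \<psi> \<longleftrightarrow> \<phi> [A] = \<psi> [A] \<and> \<phi> [B] = \<psi> [B]"
  unfolding eq_on_words_def using assms by (metis endomorphism_eq_morph list.distinct(1))

lemma endomorphism_mu_pow: "endomorphism (mu ^^ n)"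
proof -
  have "(mu ^^ n) u \<noteq> []" if "u \<noteq> []" for u
    using length_mu_pow[of n u] that by (metis length_0_conv mult_eq_0_iff power_not_zero zero_neq_numeral)
  then show ?thesis
    by (simp add: endomorphism_def mu_pow_append)
qed

lemma endomorphism_xi_mu_pow: "endomorphism (xi \<circ> mu ^^ n)"
  using endomorphism_mu_pow[of n] by (auto simp: endomorphism_def xi_eq_map_flip)

lemma typical_pair_iff:
  assumes "endomorphism \<phi>"
  shows "typical_pair (\<phi> [A]) (\<phi> [B]) \<longleftrightarrow>
    (\<exists>n. eq_on_words \<phi> (mu ^^ n) \<or> eq_on_words \<phi> (xi \<circ> mu ^^ n))"
proof -
  have B: "(mu ^^ n) [B] = xi ((mu ^^ n) [A])" for n
    using mu_pow_flip[of n A] by simp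
  have ex_letter: "(\<exists>x. P x) \<longleftrightarrow> P A \<or> P B" for P
    by (metis letter.exhaust)
  have "typical_pair u v \<longleftrightarrow> (\<exists>n. (u = (mu ^^ n) [A] \<and> v = (mu ^^ n) [B]) \<or>
      (u = (mu ^^ n) [B] \<and> v = (mu ^^ n) [A]))" for u v
    unfolding typical_pair_def by (simp add: ex_letter)
  then show ?thesis
    by (simp add: eq_on_words_iff[OF assms] endomorphism_mu_pow endomorphism_xi_mu_pow B)
qed

text \<open>The quantifier over functions becomes one over the two letter images, on which the
  descent operates.\<close>

lemma atypical_iff:
  "atypical w \<longleftrightarrow> segment w ptm \<and>
    (\<exists>u v. u \<noteq> [] \<and> v \<noteq> [] \<and> segment (morph u v w) ptm \<and> \<not> typical_pair u v)"
proof
  assume "atypical w"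
  then obtain \<phi> where *: "segment w ptm" "endomorphism \<phi>" "segment (\<phi> w) ptm"
      "\<not> typical_pair (\<phi> [A]) (\<phi> [B])"
    unfolding atypical_def using typical_pair_iff by blast
  then have "\<phi> w = morph (\<phi> [A]) (\<phi> [B]) w"
    using endomorphism_eq_morph segment_iff by blast
  moreover have "\<phi> [A] \<noteq> []" "\<phi> [B] \<noteq> []"
    using *(2) by (auto simp: endomorphism_def)
  ultimately show "segment w ptm \<and>
    (\<exists>u v. u \<noteq> [] \<and> v \<noteq> [] \<and> segment (morph u v w) ptm \<and> \<not> typical_pair u v)"
    using * by metis
next
  assume "segment w ptm \<and>
    (\<exists>u v. u \<noteq> [] \<and> v \<noteq> [] \<and> segment (morph u v w) ptm \<and> \<not> typical_pair u v)"
  then obtain u v where *: "segment w ptm" "u \<noteq> []" "v \<noteq> []" "segment (morph u v w) ptm"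
      "\<not> typical_pair u v"
    by blast
  then show "atypical w"
    unfolding atypical_def using typical_pair_iff[OF endomorphism_morph[OF *(2,3)]] endomorphism_morph
    by auto
qed

text \<open>The same pair of images is a witness for the factor.\<close>

lemma atypical_sublist:
  assumes "atypical w" "sublist w' w" "w' \<noteq> []"
  shows "atypical w'"
proof -
  obtain u v where *: "segment w ptm" "u \<noteq> []" "v \<noteq> []" "segment (morph u v w) ptm"
      "\<not> typical_pair u v"
    using assms(1) atypical_iff by blast
  moreover have "sublist (morph u v w') (morph u v w)"
    using assms(2) unfolding sublist_def by (metis morph_append)
  ultimately show ?thesis
    unfolding atypical_iff using assms segment_sublist morph_eq_Nil by metis
qed

lemma atypical_rev: "atypical (rev w) \<longleftrightarrow> atypical w"
proof -
  have "atypical (rev w)" if "atypical w" for w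
    using that unfolding atypical_iff
    by (metis morph_rev rev_is_Nil_conv rev_rev_ident segment_rev typical_pair_rev)
  from this[of w] this[of "rev w"] show ?thesis by auto
qed

lemma atypical_xi: "atypical (xi w) \<longleftrightarrow> atypical w"
proof -
  have "atypical (xi w)" if "atypical w" for w
    using that unfolding atypical_iff by (metis morph_xi segment_xi typical_pair_commute)
  from this[of w] this[of "xi w"] show ?thesis by auto
qed

lemma atypical_variants: "v \<in> variants w \<Longrightarrow> atypical v \<longleftrightarrow> atypical w"
  by (auto simp: variants_def atypical_rev atypical_xi)


section \<open>Descent\<close>

text \<open>Conjugation by the common last letter: each \<open>x\<close> closing one image is read
  as opening the next.\<close>

lemma morph_rotate:
  assumes "u \<noteq> []" "v \<noteq> []" "last u = x" "last v = x"
  shows "morph (x # butlast u) (x # butlast v) m @ [x] = x # morph u v m"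
proof (induction m)
  case (Cons y m)
  have "butlast u @ [x] = u" "butlast v @ [x] = v"
    using append_butlast_last_id[OF assms(1)] append_butlast_last_id[OF assms(2)] assms(3,4) by simp_all
  then show ?case
    using Cons by (cases y) (simp_all flip: append_assoc, simp_all)
qed simp

text \<open>The part of \<open>m\<close> before \<open>w\<close> has an image of even length, which
  preserves the parity of the position.\<close>

lemma occurs_at_factor:
  assumes "occurs_at k (morph u v m)" "sublist w m" "even (length u)" "even (length v)"
  obtains j where "even (j + k)" "occurs_at j (morph u v w)"
proof -
  obtain p s where m: "m = p @ w @ s"
    using assms(2) by (auto simp: sublist_def)
  have "even (length (morph u v p))"
  proof (induction p)
    case (Cons x p)
    then show ?case using assms(3,4) by (cases x) auto
  qed simp
  with that[of "k + length (morph u v p)"] assms(1) show ?thesis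
    unfolding m by (simp add: morph_append)
qed

text \<open>The image of the factor \<open>[A, B]\<close> shows both \<open>u\<close> and
  \<open>v\<close> at even positions, where they split into blocks.\<close>

lemma even_morph_at_even:
  assumes "occurs_at k (morph u v m)" "even k" "even (length u)" "even (length v)"
    "sublist [A, B] m"
  obtains u' v' where "u = mu u'" "v = mu v'" "occurs_at (k div 2) (morph u' v' m)"
proof -
  obtain j where j: "even (j + k)" "occurs_at j (morph u v [A, B])"
    using occurs_at_factor assms by blast
  then have "even j" "even (j + length u)" "occurs_at j u" "occurs_at (j + length u) v"
    using assms(2,3) by auto
  then obtain u' v' where uv: "u = mu u'" "v = mu v'"
    using assms(3,4) occurs_at_even_imp_mu by metis
  then show ?thesis
    using that assms(1,2) occurs_at_mu[of "k div 2" "morph u' v' m"] by (auto simp: mu_morph)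
qed

text \<open>Rotation yields an even start. The equal first letters of the new images are what later
  contradicts \<open>typical_pair_hd\<close>.\<close>

lemma even_morph_at_odd:
  assumes "occurs_at k (morph u v m)" "odd k" "even (length u)" "even (length v)" "u \<noteq> []" "v \<noteq> []"
    "sublist [A, B] m" "sublist [B, A] m" "sublist [B, B] m"
  obtains u' v' where "length u' = length u" "length v' = length v" "hd u' = hd v'"
    "occurs_at (k - 1) (morph u' v' m)"
proof -
  define x where "x = last u"
  \<comment> \<open>All boundaries between images are at odd positions, hence inside a block of
    \<open>mu\<close>.\<close>
  have *: "last (morph u v [y]) \<noteq> hd (morph u v [z])" if yz: "sublist [y, z] m" for y z
  proof -
    obtain j where j: "even (j + k)" "occurs_at j (morph u v [y, z])"
      using occurs_at_factor[OF assms(1) yz assms(3,4)] by blast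
    then show ?thesis
      using last_neq_hd[of j "morph u v [y]" "morph u v [z]"] assms(2-6)
      by (cases y; cases z) auto
  qed
  \<comment> \<open>Over two letters, the three inequalities determine these letters from
    \<open>last u\<close>.\<close>
  from *[of A B] *[of B A] *[of B B] assms have heads: "last v = x" "hd u = flip x" "hd v = flip x"
    unfolding x_def by (auto simp: neq_iff_flip)
  obtain y m' where m: "m = y # m'"
    using assms(7) by (cases m) auto
  have "ptm k = flip x"
    using assms(1,5,6) heads unfolding m by (cases y; cases u; cases v) auto
  moreover obtain q where q: "k = Suc (2 * q)"
    using assms(2) by (auto elim!: oddE)
  ultimately have "ptm q = x"
    by (metis flip_flip ptm_Suc_double)
  then have "occurs_at (k - 1) (x # morph u v m)"
    using q assms(1) by simp
  then have "occurs_at (k - 1) (morph (x # butlast u) (x # butlast v) m)"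
    using morph_rotate[of u v x m] assms(5,6) heads(1) unfolding x_def
    by (metis occurs_at_append)
  moreover have "length (x # butlast u) = length u" "length (x # butlast v) = length v"
    using assms(5,6) by simp_all
  ultimately show ?thesis
    using that by (metis list.sel(1))
qed

text \<open>The hypothesis \<open>parity\<close> isolates the argument specific to each word; the
  rest is a descent on the length of \<open>u\<close>.\<close>

lemma typical_pair_by_descent:
  assumes parity: "\<And>k u v. occurs_at k (morph u v m) \<Longrightarrow> u \<noteq> [] \<Longrightarrow> v \<noteq> [] \<Longrightarrow> \<not> typical_pair u v \<Longrightarrow>
      even (length u) \<and> even (length v)"
    and m: "sublist [A, B] m" "sublist [B, A] m" "sublist [B, B] m"
  shows "occurs_at k (morph u v m) \<Longrightarrow> u \<noteq> [] \<Longrightarrow> v \<noteq> [] \<Longrightarrow> typical_pair u v"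
proof (induction "length u" arbitrary: k u v rule: less_induct)
  case less
  \<comment> \<open>Stated for any images of the same lengths, so that it serves both
    \<open>u\<close>, \<open>v\<close> and the rotated pair.\<close>
  have even_case: "typical_pair u' v'"
    if uv': "occurs_at j (morph u' v' m)" "even j" "length u' = length u" "length v' = length v"
      "even (length u)" "even (length v)" for j u' v'
  proof -
    obtain u'' v'' where uv: "u' = mu u''" "v' = mu v''" "occurs_at (j div 2) (morph u'' v'' m)"
      using even_morph_at_even[OF uv'(1,2)] uv' m by metis
    moreover have "length u > 0" "length v > 0"
      using less.prems by simp_all
    moreover have "length u = 2 * length u''" "length v = 2 * length v''"
      using uv uv'(3,4) by (simp_all add: length_mu)
    ultimately have "length u'' < length u" "u'' \<noteq> []" "v'' \<noteq> []"
      by auto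
    then have "typical_pair u'' v''"
      using less.hyps uv(3) by blast
    then show ?thesis
      unfolding uv by (rule typical_pair_mu)
  qed
  show ?case
  proof (rule ccontr)
    assume "\<not> typical_pair u v"
    then have ev: "even (length u)" "even (length v)"
      using parity less.prems by blast+
    with even_case less.prems \<open>\<not> typical_pair u v\<close> have "odd k"
      by blast
    obtain u' v' where "length u' = length u" "length v' = length v" "hd u' = hd v'"
      "occurs_at (k - 1) (morph u' v' m)"
      by (rule even_morph_at_odd[OF less.prems(1) \<open>odd k\<close> ev less.prems(2,3) m])
    moreover have "even (k - 1)"
      using \<open>odd k\<close> by simp
    ultimately show False
      using even_case[of "k - 1" u' v'] ev typical_pair_hd by metis
  qed
qed


section \<open>The minimal words that are not atypical\<close>

definition minimal_words :: "letter list set" where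
  "minimal_words =
     {[A, A, B, A, B, B], [A, A, B, B, A, B], [A, B, A, B, B, A], [A, B, B, A, A, B, B, A]}"

text \<open>The finite check of the exceptional pairs: five levels of desubstitution leave only the
  identity and the exchange.\<close>

lemma desubstitutable_alternating:
  "\<forall>m \<in> minimal_words.
     \<forall>u \<in> alternating_words. \<forall>v \<in> alternating_words.
       u \<noteq> [] \<longrightarrow> v \<noteq> [] \<longrightarrow> odd (length u) \<or> odd (length v) \<longrightarrow> desubstitutable 5 (morph u v m) \<longrightarrow>
       u = [A] \<and> v = [B] \<or> u = [B] \<and> v = [A]"
  by code_simp

text \<open>The finite check refutes odd lengths once both images are alternating;
  \<open>alt\<close> leaves that point to each word.\<close>

lemma even_if_alternating:
  assumes m: "m \<in> minimal_words"
    and uv: "occurs_at k (morph u v m)" "u \<noteq> []" "v \<noteq> []" "\<not> typical_pair u v"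
    and alt: "odd (length u) \<or> odd (length v) \<Longrightarrow> u \<in> alternating_words \<and> v \<in> alternating_words"
  shows "even (length u) \<and> even (length v)"
proof (rule ccontr)
  assume odd: "\<not> (even (length u) \<and> even (length v))"
  have "desubstitutable 5 (morph u v m)"
    using uv(1-3) m by (intro desubstitutable_if_occurs_at) (auto simp: morph_eq_Nil minimal_words_def)
  then have "u = [A] \<and> v = [B] \<or> u = [B] \<and> v = [A]"
    using desubstitutable_alternating m alt odd uv(2,3) by blast
  then show False
    using uv(4) typical_pair_letters[of A] typical_pair_letters[of B] by auto
qed

section \<open>Parity of the image lengths, word by word\<close>

lemma hd_eq_last_if_odd_square:
  assumes "occurs_at k u" "occurs_at (k + length u) u" "odd (length u)"
  shows "hd u = last u"
  using odd_square[OF assms] by (auto simp: odd_alternating_words_def)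

text \<open>From an even start the two copies would meet at an odd position, where
  \<open>last_neq_hd\<close> contradicts the equal ends of \<open>u\<close>.\<close>

lemma odd_square_at_odd:
  assumes "occurs_at k u" "occurs_at (k + length u) u" "odd (length u)"
  shows "odd k"
proof -
  have "u \<noteq> []"
    using assms(3) by auto
  then show ?thesis
    using last_neq_hd[OF assms(1,2)] hd_eq_last_if_odd_square[OF assms] assms(3) by auto
qed

lemma alternating_if_odd_square:
  assumes "occurs_at k u" "occurs_at (k + length u) u" "odd (length u)"
  shows "u \<in> alternating_words"
  using occurs_at_both_parities[OF assms(1,2)] assms(3) by simp

lemma parity_AABABB:
  assumes "occurs_at k (morph u v [A, A, B, A, B, B])" "u \<noteq> []" "v \<noteq> []" "\<not> typical_pair u v"
  shows "even (length u) \<and> even (length v)"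
proof (rule even_if_alternating[OF _ assms])
  let ?l = "length u" and ?m = "length v"
  note occ = assms(1)[simplified, unfolded add.assoc[symmetric]]
  assume "odd ?l \<or> odd ?m"
  then consider "odd ?l" "odd ?m" | "odd (?l + ?m)"
    by auto
  then show "u \<in> alternating_words \<and> v \<in> alternating_words"
  proof cases
    case 1
    then show ?thesis
      using alternating_if_odd_square[of k u] alternating_if_odd_square[of "k + ?l + ?l + ?m + ?l" v] occ
      by blast
  next
    case 2
    \<comment> \<open>Each image has two occurrences at the odd distance
      \<open>?l + ?m\<close>.\<close>
    then have "odd ((k + ?l) + (k + ?l + ?l + ?m))" "odd ((k + ?l + ?l) + (k + ?l + ?l + ?m + ?l))"
      by auto
    then show ?thesis
      using occurs_at_both_parities occ by blast
  qed
qed (simp add: minimal_words_def)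

lemma parity_ABABBA:
  assumes "occurs_at k (morph u v [A, B, A, B, B, A])" "u \<noteq> []" "v \<noteq> []" "\<not> typical_pair u v"
  shows "even (length u) \<and> even (length v)"
proof (rule even_if_alternating[OF _ assms])
  let ?l = "length u" and ?m = "length v"
  note occ = assms(1)[simplified, unfolded add.assoc[symmetric]]
  assume "odd ?l \<or> odd ?m"
  then consider "odd ?l" "odd ?m" | "odd (?l + ?m)"
    by auto
  then show "u \<in> alternating_words \<and> v \<in> alternating_words"
  proof cases
    case 1
    \<comment> \<open>The second and third copies of \<open>u\<close> are at distance
      \<open>?l + 2 * ?m\<close>.\<close>
    then have "odd ((k + ?l + ?m) + (k + ?l + ?m + ?l + ?m + ?m))"
      by auto
    then show ?thesis
      using 1 occurs_at_both_parities alternating_if_odd_square[of "k + ?l + ?m + ?l" v] occ by blast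
  next
    case 2
    then have "odd (k + (k + ?l + ?m))" "odd ((k + ?l) + (k + ?l + ?m + ?l))"
      by auto
    then show ?thesis
      using occurs_at_both_parities occ by blast
  qed
qed (simp add: minimal_words_def)

lemma parity_AABBAB:
  assumes "occurs_at k (morph u v [A, A, B, B, A, B])" "u \<noteq> []" "v \<noteq> []" "\<not> typical_pair u v"
  shows "even (length u) \<and> even (length v)"
proof (rule even_if_alternating[OF _ assms])
  let ?l = "length u" and ?m = "length v"
  note occ = assms(1)[simplified, unfolded add.assoc[symmetric]]
  assume "odd ?l \<or> odd ?m"
  then consider "odd ?l" "odd ?m" | "odd ?l" "even ?m" | "even ?l" "odd ?m"
    by auto
  then show "u \<in> alternating_words \<and> v \<in> alternating_words"
  proof cases
    case 1
    then show ?thesis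
      using alternating_if_odd_square[of k u] alternating_if_odd_square[of "k + ?l + ?l" v] occ by blast
  next
    case 2
    \<comment> \<open>The second and third copies of \<open>v\<close> are at distance
      \<open>?l + ?m\<close>.\<close>
    then have "odd ((k + ?l + ?l + ?m) + (k + ?l + ?l + ?m + ?m + ?l))"
      by auto
    then show ?thesis
      using 2 alternating_if_odd_square[of k u] occurs_at_both_parities occ by blast
  next
    case 3
    \<comment> \<open>This case is impossible: \<open>hd u\<close>, \<open>last u\<close> and
      \<open>hd v\<close> would be pairwise different.\<close>
    then have "odd (k + ?l + ?l)" "hd v = last v"
      using odd_square_at_odd hd_eq_last_if_odd_square occ by blast+
    then have "odd (k + ?l)" "odd (k + ?l + ?l)" "odd (k + ?l + ?l + ?m + ?m)"
      using 3 by auto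
    then have "last u \<noteq> hd u" "last u \<noteq> hd v" "last v \<noteq> hd u"
      using last_neq_hd occ assms(2,3) by blast+
    with \<open>hd v = last v\<close> show ?thesis
      by (metis neq_iff_flip)
  qed
qed (simp add: minimal_words_def)

lemma parity_ABBAABBA:
  assumes "occurs_at k (morph u v [A, B, B, A, A, B, B, A])" "u \<noteq> []" "v \<noteq> []" "\<not> typical_pair u v"
  shows "even (length u) \<and> even (length v)"
proof (rule even_if_alternating[OF _ assms])
  let ?l = "length u" and ?m = "length v"
  note occ = assms(1)[simplified, unfolded add.assoc[symmetric]]
  assume "odd ?l \<or> odd ?m"
  then consider "odd ?l" "odd ?m" | "odd ?l" "even ?m" | "even ?l" "odd ?m"
    by auto
  then show "u \<in> alternating_words \<and> v \<in> alternating_words"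
  proof cases
    case 1
    then show ?thesis
      using alternating_if_odd_square[of "k + ?l + ?m + ?m" u] alternating_if_odd_square[of "k + ?l" v]
        occ by blast
  next
    case 2
    \<comment> \<open>Impossible again: \<open>hd u\<close>, \<open>hd v\<close> and
      \<open>last v\<close> would be pairwise different. The next case does the same with
      \<open>hd u\<close>, \<open>last u\<close> and \<open>hd v\<close>.\<close>
    then have "odd (k + ?l + ?m + ?m)" "hd u = last u"
      using odd_square_at_odd hd_eq_last_if_odd_square occ by blast+
    then have "odd (k + ?l)" "odd (k + ?l + ?m)" "odd (k + ?l + ?m + ?m)"
      using 2 by auto
    then have "last u \<noteq> hd v" "last v \<noteq> hd v" "last v \<noteq> hd u"
      using last_neq_hd occ assms(2,3) by blast+
    with \<open>hd u = last u\<close> show ?thesis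
      by (metis neq_iff_flip)
  next
    case 3
    then have "odd (k + ?l)" "hd v = last v"
      using odd_square_at_odd hd_eq_last_if_odd_square occ by blast+
    then have "odd (k + ?l)" "odd (k + ?l + ?m + ?m)" "odd (k + ?l + ?m + ?m + ?l)"
      using 3 by auto
    then have "last u \<noteq> hd v" "last v \<noteq> hd u" "last u \<noteq> hd u"
      using last_neq_hd occ assms(2,3) by blast+
    with \<open>hd v = last v\<close> show ?thesis
      by (metis neq_iff_flip)
  qed
qed (simp add: minimal_words_def)

lemma not_atypical_minimal:
  assumes "m \<in> minimal_words"
  shows "\<not> atypical m"
proof -
  have parity: "even (length u) \<and> even (length v)"
    if "occurs_at k (morph u v m)" "u \<noteq> []" "v \<noteq> []" "\<not> typical_pair u v" for k u v
  proof -
    from assms consider "m = [A, A, B, A, B, B]" | "m = [A, A, B, B, A, B]" | "m = [A, B, A, B, B, A]"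
      | "m = [A, B, B, A, A, B, B, A]"
      unfolding minimal_words_def by blast
    then show ?thesis
    proof cases
      case 1 then show ?thesis using that parity_AABABB by metis
    next
      case 2 then show ?thesis using that parity_AABBAB by metis
    next
      case 3 then show ?thesis using that parity_ABABBA by metis
    next
      case 4 then show ?thesis using that parity_ABBAABBA by metis
    qed
  qed
  have "sublist [A, B] m" "sublist [B, A] m" "sublist [B, B] m"
    using assms by (auto simp: minimal_words_def sublist_Cons_right)
  then have "typical_pair u v" if "occurs_at k (morph u v m)" "u \<noteq> []" "v \<noteq> []" for k u v
    using typical_pair_by_descent[OF parity _ _ _ that] by simp
  then show ?thesis
    by (auto simp: atypical_iff segment_iff)
qed


section \<open>Words of length at most eight\<close>

text \<open>Typical images have equal length \<open>2 ^ n\<close>, so unequal lengths certify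
  atypicality; a fixed prefix makes both occurrences computable.\<close>

lemma atypical_witness:
  assumes "sublist w ((mu ^^ 7) [A])" "sublist (morph u v w) ((mu ^^ 7) [A])"
    and "w \<noteq> []" "u \<noteq> []" "v \<noteq> []" "length u \<noteq> length v"
  shows "atypical w"
proof -
  have "\<not> typical_pair u v"
    using assms(6) by (auto simp: typical_pair_def length_mu_pow)
  moreover have "segment w ptm" "segment (morph u v w) ptm"
    using assms by (auto simp: segment_iff_sublist_mu_pow morph_eq_Nil)
  ultimately show ?thesis
    using assms(4,5) atypical_iff by blast
qed

lemma atypical_AABAB: "atypical [A, A, B, A, B]"
  by (rule atypical_witness[of _ "[A]" "[B, B, A, A, B]"]) code_simp+

lemma atypical_ABAABA: "atypical [A, B, A, A, B, A]"
  \<comment> \<open>The image is \<open>mu (mu [A, A])\<close>.\<close>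
  by (rule atypical_witness[of _ "[A]" "[B, B]"]) code_simp+

lemma atypical_AABBAAB: "atypical [A, A, B, B, A, A, B]"
  by (rule atypical_witness[of _ "[A]" "[B, A, B]"]) code_simp+

text \<open>The bound \<open>length w < 8\<close> records that every word of length eight passing
  the test has a variant containing a minimal word.\<close>

lemma short_words:
  "\<forall>w \<in> set (concat (map (\<lambda>n. List.n_lists n [A, B]) [1..<9])). desubstitutable 4 w \<longrightarrow>
     length w < 8 \<and>
       (\<exists>v \<in> variants w. sublist v [A, A, B, A, B] \<or> sublist v [A, B, A, A, B, A] \<or>
          sublist v [A, A, B, B, A, A, B]) \<or>
     (\<exists>v \<in> variants w. \<exists>m \<in> minimal_words. sublist m v)"
  by code_simp

theorem theorem4p3:
  fixes w :: "letter list"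
  assumes "w \<noteq> []"
  shows "atypical w \<longleftrightarrow>
    (\<exists>v \<in> variants w.
       sublist v [A, A, B, A, B] \<or>
       sublist v [A, B, A, A, B, A] \<or>
       sublist v [A, A, B, B, A, A, B])"
proof
  assume "atypical w"
  \<comment> \<open>The prefix is short enough for \<open>short_words\<close>, which then forces its
    length below 8, so that it is all of \<open>w\<close>.\<close>
  define w' where "w' = take 8 w"
  have w': "w' \<noteq> []" "atypical w'" "length w' \<le> 8"
    using assms \<open>atypical w\<close> atypical_sublist[of w w'] by (auto simp: w'_def)
  then obtain k where "occurs_at k w'"
    using atypical_def segment_iff by blast
  then have desub: "desubstitutable 4 w'"
    using w'(1) by (rule desubstitutable_if_occurs_at)
  have "set w' \<subseteq> {A, B}"
    using letter.exhaust by blast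
  then have mem: "w' \<in> set (concat (map (\<lambda>n. List.n_lists n [A, B]) [1..<9]))"
    using w' by (auto simp: set_n_lists Suc_le_eq)
  have "\<not> sublist m v" if "m \<in> minimal_words" "v \<in> variants w'" for m v
  proof
    assume "sublist m v"
    moreover have "atypical v" "m \<noteq> []"
      using that w'(2) atypical_variants by (auto simp: minimal_words_def)
    ultimately show False
      using not_atypical_minimal[OF that(1)] atypical_sublist by blast
  qed
  with short_words[THEN bspec, THEN mp, OF mem desub] have "length w' < 8" "\<exists>v \<in> variants w'.
      sublist v [A, A, B, A, B] \<or> sublist v [A, B, A, A, B, A] \<or> sublist v [A, A, B, B, A, A, B]"
    by blast+
  moreover have "w' = w" if "length w' < 8"
    using that by (auto simp: w'_def)
  ultimately show "\<exists>v \<in> variants w.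
      sublist v [A, A, B, A, B] \<or> sublist v [A, B, A, A, B, A] \<or> sublist v [A, A, B, B, A, A, B]"
    by simp
next
  assume "\<exists>v \<in> variants w.
      sublist v [A, A, B, A, B] \<or> sublist v [A, B, A, A, B, A] \<or> sublist v [A, A, B, B, A, A, B]"
  then obtain v where v: "v \<in> variants w"
      "sublist v [A, A, B, A, B] \<or> sublist v [A, B, A, A, B, A] \<or> sublist v [A, A, B, B, A, A, B]"
    by blast
  then have "v \<noteq> []"
    using assms by (auto simp: variants_def xi_eq_map_flip)
  then have "atypical v"
    using v(2) atypical_sublist atypical_AABAB atypical_ABAABA atypical_AABBAAB by blast
  then show "atypical w"
    using v(1) atypical_variants by blast
qed

end
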